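(* Let $A$ be a finite set and let $\rho\subseteq A^n$, $n\ge 3$, be an essential key relation preserved by a weak near-unanimity function. Then the pattern $\overset{\rho}{\sim}$ of $\rho$ is an equivalence relation on $\{1,\dots,n\}$, and at most one of its equivalence classes contains more than one element.
   Context: A unary vector-function is a tuple $\Psi=(\psi_1,\dots,\psi_n)$ of maps $\psi_i:A\to A$ acting coordinatewise; it preserves $\rho$ if $\Psi(\rho)\subseteq\rho$. $\rho\subseteq A^n$ is a key relation if there is $\beta\in A^n\setminus\rho$ (a key tuple) such that every $\alpha\in A^n\setminus\rho$ is mapped to $\beta$ by some unary vector-function preserving $\rho$. $\rho$ is essential if it cannot be written as a conjunction of relations of smaller arities (equivalently, there is a tuple $\alpha\notin\rho$ such that for each coordinate $i$, changing the $i$-th coordinate of $\alpha$ suitably yields a tuple in $\rho$). A weak near-unanimity function (WNU) is an $m$-ary ($m\ge2$) operation $f$ on $A$ with $f(x,\dots,x)=x$ and $f(y,x,\dots,x)=f(x,y,x,\dots,x)=\dots=f(x,\dots,x,y)$; $f$ preserves $\rho$ if applying $f$ coordinatewise to any $m$ tuples of $\rho$ yields a tuple of $\rho$. The pattern of $\rho$: for $i\ne j$, $i\overset{\rho}{\sim}j$ iff there do NOT exist $a_1,\dots,a_n,b_i,b_j\in A$ such that $(a_1,\dots,a_n)\notin\rho$ while the tuples obtained from $(a_1,\dots,a_n)$ by replacing $a_i$ with $b_i$, by replacing $a_j$ with $b_j$, and by replacing both, all lie in $\rho$; also $i\overset{\rho}{\sim}i$ for all $i$. *)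

theory Defs
  imports Main
begin

text \<open>Tuples in A^n are lists of length n over A; coordinates are indexed 0..<n.
  A relation rho of arity n on A is a set of such lists.\<close>

definition tuples :: "'a set \<Rightarrow> nat \<Rightarrow> 'a list set" where
  "tuples A n = {xs. length xs = n \<and> set xs \<subseteq> A}"

definition vf_apply :: "(nat \<Rightarrow> 'a \<Rightarrow> 'a) \<Rightarrow> 'a list \<Rightarrow> 'a list" where
  "vf_apply Psi xs = map (\<lambda>i. Psi i (xs ! i)) [0..<length xs]"

definition is_vf :: "'a set \<Rightarrow> nat \<Rightarrow> (nat \<Rightarrow> 'a \<Rightarrow> 'a) \<Rightarrow> bool" where
  "is_vf A n Psi \<longleftrightarrow> (\<forall>i<n. Psi i ` A \<subseteq> A)"

definition vf_preserves :: "(nat \<Rightarrow> 'a \<Rightarrow> 'a) \<Rightarrow> 'a list set \<Rightarrow> bool" where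
  "vf_preserves Psi rho \<longleftrightarrow> (\<forall>xs\<in>rho. vf_apply Psi xs \<in> rho)"

definition key_relation :: "'a set \<Rightarrow> nat \<Rightarrow> 'a list set \<Rightarrow> bool" where
  "key_relation A n rho \<longleftrightarrow> rho \<subseteq> tuples A n \<and>
     (\<exists>beta \<in> tuples A n - rho. \<forall>alpha \<in> tuples A n - rho.
        \<exists>Psi. is_vf A n Psi \<and> vf_preserves Psi rho \<and> vf_apply Psi alpha = beta)"

text \<open>A relation S (as a subset of A^n) does not depend on coordinate i, i.e. it is
  (the cylinder of) a relation of smaller arity on the remaining coordinates.\<close>

definition indep_coord :: "'a set \<Rightarrow> nat \<Rightarrow> nat \<Rightarrow> 'a list set \<Rightarrow> bool" where
  "indep_coord A n i S \<longleftrightarrow> (\<forall>xs\<in>tuples A n. \<forall>b\<in>A. xs \<in> S \<longleftrightarrow> xs[i := b] \<in> S)"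

text \<open>rho is essential iff it cannot be written as a conjunction of relations of smaller
  arities, i.e. as an intersection of relations each of which ignores some coordinate.\<close>

definition essential :: "'a set \<Rightarrow> nat \<Rightarrow> 'a list set \<Rightarrow> bool" where
  "essential A n rho \<longleftrightarrow>
     \<not> (\<exists>SS. (\<forall>S\<in>SS. \<exists>i<n. indep_coord A n i S) \<and> rho = tuples A n \<inter> \<Inter>SS)"

definition wnu :: "'a set \<Rightarrow> nat \<Rightarrow> ('a list \<Rightarrow> 'a) \<Rightarrow> bool" where
  "wnu A m f \<longleftrightarrow> m \<ge> 2 \<and>
     (\<forall>xs\<in>tuples A m. f xs \<in> A) \<and>
     (\<forall>x\<in>A. f (replicate m x) = x) \<and>
     (\<forall>x\<in>A. \<forall>y\<in>A. \<forall>i<m. \<forall>j<m.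
        f ((replicate m x)[i := y]) = f ((replicate m x)[j := y]))"

definition op_preserves :: "nat \<Rightarrow> nat \<Rightarrow> ('a list \<Rightarrow> 'a) \<Rightarrow> 'a list set \<Rightarrow> bool" where
  "op_preserves m n f rho \<longleftrightarrow>
     (\<forall>ts. length ts = m \<and> set ts \<subseteq> rho \<longrightarrow>
        map (\<lambda>k. f (map (\<lambda>t. t ! k) ts)) [0..<n] \<in> rho)"

definition pattern :: "'a set \<Rightarrow> nat \<Rightarrow> 'a list set \<Rightarrow> (nat \<times> nat) set" where
  "pattern A n rho = {(i, j). i < n \<and> j < n \<and> (i = j \<or>
     \<not> (\<exists>a\<in>tuples A n. \<exists>bi\<in>A. \<exists>bj\<in>A. a \<notin> rho \<and> a[i := bi] \<in> rho \<and>
          a[j := bj] \<in> rho \<and> a[i := bi, j := bj] \<in> rho))}"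

end

theory Submission
  imports Defs
begin

text \<open>
  Fix a key tuple \<open>\<beta>\<close>. Freezing all but a few coordinates at the entries of \<open>\<beta>\<close> again gives an
  essential key relation, so only three or four coordinates matter, and whether \<open>i \<sim> j\<close> can be read
  off at \<open>\<beta>\<close>. If \<open>i \<sim> j\<close>, the two-dimensional sections in the coordinates \<open>i, j\<close> are rectangular,
  that is, graphs of bijections between classes; at \<open>\<beta>\<close> the two entries lie in distinct classes, say
  \<open>p\<close> and \<open>q\<close>.

  If moreover \<open>i \<not>\<sim> k\<close>, then some value \<open>c\<close> at \<open>k\<close> makes the \<open>(i, j)\<close>-section contain the full square
  \<open>{p, q} \<times> {p, q}\<close> for suitable representatives: a minimal set of arguments whose votes for
  \<open>p\<close> prevent the WNU from returning \<open>q\<close> yields such a \<open>c\<close> unless \<open>q\<close> absorbs, and interchanging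
  \<open>p\<close> and \<open>q\<close> shows that both would absorb. In particular \<open>j \<not>\<sim> k\<close>, which is transitivity.

  If \<open>i \<sim> j\<close> and \<open>k \<sim> l\<close> lay in different classes, such squares would exist in both directions. They
  force every set of arguments either to be outvoted by its complement, or to determine the value of
  the WNU on \<open>{p, q}\<close> modulo an equivalence separating \<open>p\<close> and \<open>q\<close>. Splitting a minimal set of
  the second kind gives a contradiction.
\<close>

section \<open>Mixed votes and rectangular relations\<close>

definition mix :: "nat set \<Rightarrow> 'a \<Rightarrow> 'a \<Rightarrow> nat \<Rightarrow> 'a" where
  "mix T x y = (\<lambda>i. if i \<in> T then x else y)"

lemma mix_apply: "mix T x y i = (if i \<in> T then x else y)"
  by (simp add: mix_def)

definition rectangular :: "('a \<Rightarrow> 'b \<Rightarrow> bool) \<Rightarrow> bool" where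
  "rectangular B \<longleftrightarrow> (\<forall>x x' y y'. B x y \<and> B x' y \<and> B x' y' \<longrightarrow> B x y')"

lemma rectangularD: "rectangular B \<Longrightarrow> B x y \<Longrightarrow> B x' y \<Longrightarrow> B x' y' \<Longrightarrow> B x y'"
  unfolding rectangular_def by blast

text \<open>Below, \<open>B\<close> will be the graph of a bijection between two quotients of subsets of \<open>A\<close>, and
  \<open>u\<close>, \<open>v\<close> lie in different classes. Then \<open>vote_equiv F B u v T T'\<close> says that \<open>F\<close> has the same
  value, up to classes, when the arguments equal to \<open>u\<close> are those in \<open>T\<close> or those in \<open>T'\<close>, the others
  being \<open>v\<close>; the elements \<open>a\<close> and \<open>b\<close> represent \<open>v\<close> on the left and \<open>u\<close> on the right.\<close>

definition vote_equiv ::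
  "((nat \<Rightarrow> 'a) \<Rightarrow> 'a) \<Rightarrow> ('a \<Rightarrow> 'a \<Rightarrow> bool) \<Rightarrow> 'a \<Rightarrow> 'a \<Rightarrow> nat set \<Rightarrow> nat set \<Rightarrow> bool" where
  "vote_equiv F B u v T T' \<longleftrightarrow>
     (\<exists>a b. B a v \<and> B u b \<and> B (F (mix T u a)) (F (mix T' b v)))"

text \<open>Some coarsening of \<open>K\<close> depends only on the votes in \<open>S\<close> but still separates the two
  unanimous votes.\<close>

definition determined_by :: "(nat set \<Rightarrow> nat set \<Rightarrow> bool) \<Rightarrow> nat set \<Rightarrow> bool" where
  "determined_by K S \<longleftrightarrow> (\<exists>C. rectangular C \<and> (\<forall>T T'. K T T' \<longrightarrow> C T T') \<and>
     (\<forall>T T'. T \<inter> S = T' \<inter> S \<longrightarrow> C T T') \<and> \<not> C UNIV {})"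

locale wnu_family =
  fixes A :: "'a set" and m :: nat and F :: "(nat \<Rightarrow> 'a) \<Rightarrow> 'a"
  assumes arity: "m \<ge> 2"
    and F_cong: "\<And>x y. (\<And>t. t < m \<Longrightarrow> x t = y t) \<Longrightarrow> F x = F y"
    and F_closed: "\<And>x. (\<And>t. t < m \<Longrightarrow> x t \<in> A) \<Longrightarrow> F x \<in> A"
    and F_idem: "\<And>x. x \<in> A \<Longrightarrow> F (\<lambda>_. x) = x"
    and F_wnu: "\<And>x y i j. x \<in> A \<Longrightarrow> y \<in> A \<Longrightarrow> i < m \<Longrightarrow> j < m \<Longrightarrow>
      F ((\<lambda>_. x)(i := y)) = F ((\<lambda>_. x)(j := y))"
begin

lemma F_mix_full: "x \<in> A \<Longrightarrow> {..<m} \<subseteq> T \<Longrightarrow> F (mix T x y) = x"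
  using F_cong[of "mix T x y" "\<lambda>_. x"] F_idem[of x] by (simp add: mix_apply subset_iff)

lemma F_mix_empty: "y \<in> A \<Longrightarrow> F (mix {} x y) = y"
  using F_idem[of y] by (simp add: mix_def)

lemma F_mix_single:
  assumes "x \<in> A" "y \<in> A" "s < m" "t < m"
  shows "F (mix {s} x y) = F (mix {t} x y)"
proof -
  have "mix {r} x y = (\<lambda>_. y)(r := x)" for r
    by (auto simp: mix_def)
  then show ?thesis using F_wnu[of y x s t] assms by simp
qed

lemma F_mix_cosingle:
  assumes "x \<in> A" "y \<in> A" "s < m" "t < m"
  shows "F (mix ({..<m} - {s}) x y) = F (mix ({..<m} - {t}) x y)"
proof -
  have "F (mix ({..<m} - {r}) x y) = F ((\<lambda>_. x)(r := y))" for r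
    by (rule F_cong) (auto simp: mix_def)
  then show ?thesis using F_wnu[of x y s t] assms by simp
qed

end

section \<open>Abstract voting systems\<close>

locale voting =
  fixes m :: nat and K :: "nat set \<Rightarrow> nat set \<Rightarrow> bool"
  assumes voters: "m \<ge> 2"
    and K_rect: "rectangular K"
    and K_agree: "\<And>T T'. T \<inter> {..<m} = T' \<inter> {..<m} \<Longrightarrow> K T T'"
    and K_single: "\<And>s t. s < m \<Longrightarrow> t < m \<Longrightarrow> K {s} {t}"
    and K_nontrivial: "\<not> K UNIV {}"
begin

lemma determined_by_all: "determined_by K {..<m}"
  unfolding determined_by_def using K_rect K_agree K_nontrivial by (intro exI[of _ K]) simp

lemma determined_by_nonempty: "determined_by K S \<Longrightarrow> S \<noteq> {}"
  unfolding determined_by_def by auto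

text \<open>All singletons weigh the same, and a vote outside \<open>{s}\<close> does not count for
  \<open>C\<close>; so \<open>{s}\<close> would tie with \<open>{}\<close>, although it also ties
  with \<open>UNIV\<close>.\<close>

lemma not_determined_by_single:
  assumes "s < m"
  shows "\<not> determined_by K {s}"
proof
  assume "determined_by K {s}"
  then obtain C where C: "rectangular C" "\<And>T T'. K T T' \<Longrightarrow> C T T'"
    "\<And>T T'. T \<inter> {s} = T' \<inter> {s} \<Longrightarrow> C T T'" "\<not> C UNIV {}"
    unfolding determined_by_def by blast
  obtain t where t: "t < m" "t \<noteq> s"
    using voters assms by (cases "s = 0") (auto intro: that[of 1] that[of 0])
  have "C {s} {t}" "C {t} {t}" using C(2) K_single assms t by simp_all
  moreover have "C {t} {}" using C(3) t by simp
  ultimately have "C {s} {}" by (rule rectangularD[OF C(1)])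
  moreover have "C UNIV UNIV" "C {s} UNIV" using C(3) by simp_all
  ultimately show False using rectangularD[OF C(1)] C(4) by metis
qed

text \<open>\<open>S\<close> and \<open>UNIV\<close> agree on \<open>S\<close>, so
  \<open>K S {}\<close> would identify the two unanimous votes.\<close>

lemma determined_by_not_outvoted:
  assumes "determined_by K S"
  shows "\<not> K S {}"
proof
  assume "K S {}"
  from assms obtain C where C: "rectangular C" "\<And>T T'. K T T' \<Longrightarrow> C T T'"
    "\<And>T T'. T \<inter> S = T' \<inter> S \<Longrightarrow> C T T'" "\<not> C UNIV {}"
    unfolding determined_by_def by blast
  from rectangularD[OF C(1) C(3) C(3) C(2)[OF \<open>K S {}\<close>], of UNIV UNIV] C(4) show False by simp
qed

end

text \<open>A minimal determining set \<open>S\<close> has at least two elements. Split it into two proper parts: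
  neither part is determining, so each is outvoted by its complement; but the relation witnessing
  that \<open>S\<close> is determining may not distinguish the two outcomes.\<close>

lemma no_two_votings:
  assumes V: "voting m K" and V': "voting m K'"
    and 1: "\<And>S. \<not> determined_by K S \<Longrightarrow> K' S {}"
    and 2: "\<And>S. \<not> determined_by K' S \<Longrightarrow> K S {}"
    and 3: "\<And>S. \<not> determined_by K' S \<Longrightarrow> K UNIV (- S)"
  shows False
proof -
  interpret V: voting m K by (rule V)
  interpret V': voting m K' by (rule V')
  \<comment> \<open>Thus \<open>2\<close> and \<open>3\<close> apply to every \<open>S\<close> that
    does not determine \<open>K\<close>.\<close>
  have out: "\<not> determined_by K' S" if "\<not> determined_by K S" for S
    using V'.determined_by_not_outvoted 1 that by blast
  let ?Q = "\<lambda>S. S \<subseteq> {..<m} \<and> determined_by K S"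
  obtain S where S: "?Q S" and min: "\<And>S'. ?Q S' \<Longrightarrow> card S \<le> card S'"
    using V.determined_by_all ex_has_least_nat[of ?Q "{..<m}" card] by blast
  have fin: "finite S" using S finite_subset by blast
  obtain s where s: "s \<in> S" using S V.determined_by_nonempty by blast
  let ?S = "S - {s}"
  have "card ?S < card S" using fin s by (meson card_Diff1_less)
  with min[of ?S] S have n1: "\<not> determined_by K ?S" by auto
  have n2: "\<not> determined_by K {s}" using V.not_determined_by_single S s by blast
  from conjunct2[OF S] obtain C where C: "rectangular C" "\<And>T T'. K T T' \<Longrightarrow> C T T'"
    "\<And>T T'. T \<inter> S = T' \<inter> S \<Longrightarrow> C T T'" "\<not> C UNIV {}"
    unfolding determined_by_def by blast
  \<comment> \<open>Both parts of \<open>S\<close> lose; the two pairs are linked by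
    \<open>C ?S (- {s})\<close>, whose sets agree on \<open>S\<close>.\<close>
  have "C UNIV (- {s})" "C ?S {}" using C(2) 2[OF out[OF n1]] 3[OF out[OF n2]] by simp_all
  moreover have "C ?S (- {s})" by (rule C(3)) auto
  ultimately show False using rectangularD[OF C(1)] C(4) by metis
qed

section \<open>Three coordinates: boxes and absorption\<close>

text \<open>The restriction of a key relation to three coordinates, the remaining ones being fixed to
  the entries of the key tuple, whose three entries are \<open>u\<close>, \<open>v\<close>, \<open>w\<close>.\<close>

locale ternary_key = wnu_family +
  fixes R :: "'a \<Rightarrow> 'a \<Rightarrow> 'a \<Rightarrow> bool" and u v w :: 'a
  assumes R_dom: "\<And>x y z. R x y z \<Longrightarrow> x \<in> A \<and> y \<in> A \<and> z \<in> A"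
    and key_tuple: "u \<in> A" "v \<in> A" "w \<in> A" "\<not> R u v w"
    and R_pres: "\<And>x y z. (\<And>t. t < m \<Longrightarrow> R (x t) (y t) (z t)) \<Longrightarrow> R (F x) (F y) (F z)"
    and R_key: "\<And>x y z. x \<in> A \<Longrightarrow> y \<in> A \<Longrightarrow> z \<in> A \<Longrightarrow> \<not> R x y z \<Longrightarrow>
      \<exists>p q r. p x = u \<and> q y = v \<and> r z = w \<and> (\<forall>x y z. R x y z \<longrightarrow> R (p x) (q y) (r z))"
    and R_rect: "\<And>z. rectangular (\<lambda>x y. R x y z)"
    and R_ess: "\<exists>b. R u b w"
begin

lemma R_rectD: "R x y z \<Longrightarrow> R x' y z \<Longrightarrow> R x' y' z \<Longrightarrow> R x y' z"
  using rectangularD[OF R_rect] by metis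

lemma R_pres_const:
  assumes "\<And>t. t < m \<Longrightarrow> R (x t) (y t) z"
  shows "R (F x) (F y) z"
proof -
  have "z \<in> A" using assms[of 0] arity R_dom by force
  then show ?thesis using R_pres[of x y "\<lambda>_. z"] assms F_idem by simp
qed

text \<open>At \<open>w\<close>, \<open>a\<close> is matched with \<open>v\<close> and
  \<open>u\<close> with \<open>b\<close>, so both classes are represented on both sides; at
  \<open>c\<close> all four pairs are joined.\<close>

definition box :: "'a \<Rightarrow> 'a \<Rightarrow> 'a \<Rightarrow> bool" where
  "box a b c \<longleftrightarrow> R a v w \<and> R u b w \<and> R u v c \<and> R a v c \<and> R u b c \<and> R a b c"

text \<open>A minimal set \<open>S\<close> spoiling the conclusion and \<open>S - {s}\<close> yield
  different classes at \<open>w\<close>, but the WNU identity merges them at \<open>z\<close>. A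
  unary map to the key tuple turns this square into a box.\<close>

lemma box_or_absorbing:
  assumes R0: "R x0 y0 w" "R x1 y1 w" "R x0 y1 c" "R x1 y1 c"
    and T: "\<not> {..<m} \<subseteq> T" and nbox: "\<nexists>a b c. box a b c"
  shows "R (F (mix T x0 x1)) y1 w"
proof (rule ccontr)
  assume neg: "\<not> ?thesis"
  have A: "x0 \<in> A" "x1 \<in> A" "y0 \<in> A" "y1 \<in> A" "c \<in> A" using R0 R_dom by blast+
  define X where "X T = F (mix T x0 x1)" for T
  define Y where "Y T = F (mix T y0 y1)" for T
  let ?Q = "\<lambda>S. S \<subseteq> {..<m} \<and> \<not> R (X S) y1 w"
  have "X (T \<inter> {..<m}) = X T"
    unfolding X_def by (rule F_cong) (auto simp: mix_def)
  then have Q0: "?Q (T \<inter> {..<m})" using neg by (simp add: X_def)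
  then obtain S where S: "?Q S" and min: "\<And>S'. ?Q S' \<Longrightarrow> card S \<le> card S'"
    using ex_has_least_nat[of ?Q "T \<inter> {..<m}" card] by blast
  have fin: "finite S" using S finite_subset by blast
  have "card (T \<inter> {..<m}) < card {..<m}" using T by (intro psubset_card_mono) auto
  then have "card S < card {..<m}" using min[OF Q0] by linarith
  then obtain t where t: "t < m" "t \<notin> S"
    using S by (metis lessThan_iff less_irrefl subsetI subset_antisym)
  have "X {} = x1" unfolding X_def using A F_mix_empty by blast
  then obtain s where s: "s \<in> S" using S R0 by fastforce
  define S' where "S' = S - {s}"
  have "card S' < card S" unfolding S'_def using fin s by (meson card_Diff1_less)
  then have RS': "R (X S') y1 w" using min[of S'] S unfolding S'_def by force
  \<comment> \<open>Voters outside \<open>S\<close> take \<open>c\<close>, where \<open>y1\<close>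
    goes with both \<open>x0\<close> and \<open>x1\<close>; so only votes inside \<open>S\<close>
    bind the second coordinate.\<close>
  define z where "z = F (mix S w c)"
  have Rz: "R (X T) (Y (T \<inter> S)) z" for T
    unfolding X_def Y_def z_def by (rule R_pres) (use R0 in \<open>auto simp: mix_apply\<close>)
  have Rw: "R (X T) (Y T) w" for T
    unfolding X_def Y_def by (rule R_pres_const) (use R0 in \<open>auto simp: mix_apply\<close>)
  \<comment> \<open>Two equal values on the left whose partners at \<open>z\<close> are
    \<open>Y S\<close> and \<open>Y S'\<close>.\<close>
  have X: "X ({..<m} - {t}) = X ({..<m} - {s})"
    unfolding X_def using F_mix_cosingle A s S t by blast
  have i: "({..<m} - {t}) \<inter> S = S" "({..<m} - {s}) \<inter> S = S'" "S' \<inter> S = S'"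
    using S t unfolding S'_def by auto
  have 1: "R (X S) (Y S) z" using Rz[of S] by simp
  have 2: "R (X S) (Y S') z"
    using R_rectD[OF 1] Rz[of "{..<m} - {t}"] Rz[of "{..<m} - {s}"] X i by metis
  have 3: "R (X S') (Y S') z" using Rz[of S'] i by simp
  \<comment> \<open>Otherwise \<open>X S\<close> would reach \<open>y1\<close> through
    \<open>X S'\<close>.\<close>
  have "\<not> R (X S) (Y S') w" using R_rectD[OF _ Rw RS'] S by blast
  then obtain p q r where pqr: "p (X S) = u" "q (Y S') = v" "r w = w"
    "\<And>x y z. R x y z \<Longrightarrow> R (p x) (q y) (r z)"
    using R_key[of "X S" "Y S'" w] R_dom[OF 2] key_tuple by blast
  have "box (p (X S')) (q (Y S)) (r z)"
    unfolding box_def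
    using pqr(4)[OF Rw[of S]] pqr(4)[OF Rw[of S']] pqr(4)[OF 1] pqr(4)[OF 2] pqr(4)[OF 3] pqr(1-3)
      R_rectD by metis
  then show False using nbox by blast
qed

text \<open>A unary map interchanging the classes of \<open>u\<close> and \<open>v\<close> turns \<open>c\<close>, constantly in the class of
  \<open>v\<close>, into some \<open>c'\<close> constantly in the class of \<open>u\<close>; without a box, \<open>F\<close> would be absorbed by both
  classes.\<close>

lemma box_exists:
  assumes ac: "R a v w" "R u v c" "R a v c"
  shows "\<exists>a b c. box a b c"
proof (rule ccontr)
  assume nbox: "\<nexists>a b c. box a b c"
  obtain b where b: "R u b w" using R_ess by blast
  \<comment> \<open>\<open>(a, b, w)\<close> has the classes of the key tuple interchanged, so the
    maps sending it there swap them.\<close>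
  have "\<not> R a b w" using R_rectD[OF b _ ac(1)] key_tuple by blast
  then obtain p q r where pqr: "p a = u" "q b = v" "r w = w"
    "\<And>x y z. R x y z \<Longrightarrow> R (p x) (q y) (r z)"
    using R_key[of a b w] R_dom ac b by blast
  have 1: "R u (q v) w" "R (p u) v w" "R u (q v) (r c)" "R (p u) (q v) (r c)"
    using pqr(4)[OF ac(1)] pqr(4)[OF b] pqr(4)[OF ac(3)] pqr(4)[OF ac(2)] pqr(1-3) by simp_all
  let ?X = "\<lambda>a. F (mix {0} u a)" and ?Y = "F (mix {0} b v)"
  have m: "\<not> {..<m} \<subseteq> {0}" "\<not> {..<m} \<subseteq> - {0}"
    using arity by (auto simp: subset_iff intro: exI[of _ 1] exI[of _ 0])
  have q: "R (?X a) v w" by (rule box_or_absorbing[OF b ac(1) ac(2) ac(3) m(1) nbox])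
  \<comment> \<open>Now \<open>u\<close> is the absorbing side; the complement of \<open>{0}\<close>
    makes this the same mixed vote as before, up to representatives.\<close>
  have "R (F (mix (- {0}) (p u) u)) (q v) w"
    by (rule box_or_absorbing[OF 1(2) 1(1) 1(4) 1(3) m(2) nbox])
  moreover have "mix (- {0}) (p u) u = mix {0} u (p u)" by (auto simp: mix_def)
  ultimately have p: "R (?X (p u)) (q v) w" by simp
  have XY: "R (?X a') ?Y w" if "R a' v w" for a'
    by (rule R_pres_const) (use b that in \<open>auto simp: mix_apply\<close>)
  have "R (?X (p u)) v w" using R_rectD[OF XY[OF 1(2)] XY[OF ac(1)] q] .
  then show False using R_rectD[OF 1(1) p] key_tuple by blast
qed

text \<open>Preservation at the fixed entry \<open>w\<close> makes \<open>F\<close> compatible with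
  the classes, so the choice of representatives is immaterial.\<close>

lemma vote_equiv_iff:
  assumes "R a v w" "R u b w"
  shows "vote_equiv F (\<lambda>x y. R x y w) u v T T' \<longleftrightarrow> R (F (mix T u a)) (F (mix T' b v)) w"
proof
  have link: "R (F (mix T u a)) (F (mix T b v)) w" if "R a v w" "R u b w" for a b T
    by (rule R_pres_const) (use that in \<open>auto simp: mix_apply\<close>)
  assume "vote_equiv F (\<lambda>x y. R x y w) u v T T'"
  then obtain a' b' where ab: "R a' v w" "R u b' w"
    and E: "R (F (mix T u a')) (F (mix T' b' v)) w"
    unfolding vote_equiv_def by blast
  have "R (F (mix T u a)) (F (mix T' b' v)) w"
    using R_rectD[OF link link E] assms ab by blast
  then show "R (F (mix T u a)) (F (mix T' b v)) w"
    using R_rectD[OF _ link link] assms ab by blast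
qed (use assms in \<open>auto simp: vote_equiv_def\<close>)

lemma voting_vote_equiv:
  assumes a: "R a v w"
  shows "voting m (vote_equiv F (\<lambda>x y. R x y w) u v)"
proof -
  obtain b where b: "R u b w" using R_ess by blast
  have A: "a \<in> A" "b \<in> A" using a b R_dom by auto
  note iff = vote_equiv_iff[OF a b]
  have agree: "R (F (mix T u a)) (F (mix T' b v)) w" if "T \<inter> {..<m} = T' \<inter> {..<m}" for T T'
  proof (rule R_pres_const)
    fix t assume "t < m"
    then have "t \<in> T \<longleftrightarrow> t \<in> T'" using that by blast
    then show "R (mix T u a t) (mix T' b v t) w" using a b by (simp add: mix_apply)
  qed
  show ?thesis
  proof
    show "rectangular (vote_equiv F (\<lambda>x y. R x y w) u v)"
      unfolding rectangular_def iff using R_rectD by blast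
    show "vote_equiv F (\<lambda>x y. R x y w) u v {s} {t}" if "s < m" "t < m" for s t
      unfolding iff using agree[of "{s}" "{s}"] F_mix_single[of b v s t] that A key_tuple by simp
  qed (use arity agree key_tuple A in \<open>auto simp: iff F_mix_full F_mix_empty\<close>)
qed

text \<open>Take \<open>c\<close> from a box. At \<open>F (mix S w c)\<close> only voters in
  \<open>S\<close> are constrained; if this value excludes \<open>(u, v)\<close>, a unary map
  sending it to \<open>w\<close> pulls the matching back to a coarsening determined by
  \<open>S\<close>.\<close>

lemma determined_by_or_outvoted:
  assumes "R a v w" "R u v c" "R a v c"
  shows "\<exists>c. R u v c \<and>
    (\<forall>S. \<not> determined_by (vote_equiv F (\<lambda>x y. R x y w) u v) S \<longrightarrow> R u v (F (mix S w c)))"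
proof -
  from box_exists[OF assms] obtain a b c where "box a b c" by blast
  then have abc: "R a v w" "R u b w" "R u v c" "R a v c" "R u b c" "R a b c"
    unfolding box_def by auto
  have "determined_by (vote_equiv F (\<lambda>x y. R x y w) u v) S"
    if neg: "\<not> R u v (F (mix S w c))" for S
  proof -
    let ?z = "F (mix S w c)"
    let ?X = "\<lambda>T. F (mix T u a)" and ?Y = "\<lambda>T. F (mix T b v)"
    have "?z \<in> A" by (rule F_closed) (use key_tuple R_dom abc in \<open>auto simp: mix_apply\<close>)
    then obtain p q r where pqr: "p u = u" "q v = v" "r ?z = w"
      "\<And>x y z. R x y z \<Longrightarrow> R (p x) (q y) (r z)"
      using R_key[of u v ?z] key_tuple neg by blast
    have Rc: "R (?X T) (?Y T') c" for T T'
      by (rule R_pres_const) (use abc in \<open>auto simp: mix_apply\<close>)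
    let ?C = "\<lambda>T T'. R (p (?X T)) (q (?Y T')) w"
    have "?C T T'" if "R (?X T) (?Y T') w" for T T'
    proof -
      \<comment> \<open>A pair joined at both \<open>w\<close> and \<open>c\<close> stays joined at
        \<open>?z\<close>, by idempotence.\<close>
      have "R (F (\<lambda>_. ?X T)) (F (\<lambda>_. ?Y T')) ?z"
        by (rule R_pres) (use that Rc in \<open>auto simp: mix_apply\<close>)
      then have "R (?X T) (?Y T') ?z" using F_idem R_dom[OF that] by simp
      then show ?thesis using pqr(3,4) by metis
    qed
    moreover have "?C T T'" if "T \<inter> S = T' \<inter> S" for T T'
    proof -
      have "R (?X T) (?Y T') ?z"
      proof (rule R_pres)
        fix t
        have "t \<in> S \<Longrightarrow> t \<in> T \<longleftrightarrow> t \<in> T'" using that by blast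
        then show "R (mix T u a t) (mix T' b v t) (mix S w c t)" using abc by (auto simp: mix_apply)
      qed
      then show ?thesis using pqr(3,4) by metis
    qed
    moreover have "rectangular ?C" unfolding rectangular_def using R_rectD by blast
    moreover have "\<not> ?C UNIV {}" using key_tuple pqr by (simp add: F_mix_full F_mix_empty)
    ultimately show ?thesis
      unfolding determined_by_def vote_equiv_iff[OF abc(1,2)] by (intro exI[of _ ?C]) blast
  qed
  then show ?thesis using abc(3) by blast
qed

end

section \<open>Tuples, essentiality and the pattern\<close>

lemma nth_update_lt: "l < length xs \<Longrightarrow> xs[i := a] ! l = (if i = l then a else xs ! l)"
  by simp

lemma length_vf_apply: "length (vf_apply Psi xs) = length xs"
  by (simp add: vf_apply_def)

lemma nth_vf_apply: "i < length xs \<Longrightarrow> vf_apply Psi xs ! i = Psi i (xs ! i)"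
  by (simp add: vf_apply_def)

lemma vf_apply_update: "vf_apply Psi (xs[i := b]) = (vf_apply Psi xs)[i := Psi i b]"
  by (rule nth_equalityI) (auto simp: length_vf_apply nth_vf_apply nth_update_lt)

lemma tuples_update: "xs \<in> tuples A n \<Longrightarrow> b \<in> A \<Longrightarrow> xs[i := b] \<in> tuples A n"
  unfolding tuples_def using set_update_subset_insert[of xs i b] by auto

lemma tuples_nth: "xs \<in> tuples A n \<Longrightarrow> i < n \<Longrightarrow> xs ! i \<in> A"
  unfolding tuples_def by auto

lemma list_update_nth_other: "xs[i := a, j := xs ! j] = (if i = j then xs else xs[i := a])"
  using list_update_swap[of i j xs a "xs ! j"] by (cases "i = j") simp_all

text \<open>Otherwise \<open>rho\<close> is the intersection of the cylinders over its projections
  forgetting one coordinate.\<close>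

lemma essential_tuple:
  assumes "essential A n rho" "rho \<subseteq> tuples A n"
  shows "\<exists>a\<in>tuples A n - rho. \<forall>i<n. \<exists>b\<in>A. a[i := b] \<in> rho"
proof (rule ccontr)
  assume no: "\<not> ?thesis"
  define S where "S i = {xs \<in> tuples A n. \<exists>b\<in>A. xs[i := b] \<in> rho}" for i
  have "indep_coord A n i (S i)" for i
    unfolding indep_coord_def S_def by (simp add: tuples_update)
  moreover have "rho = tuples A n \<inter> \<Inter> (S ` {..<n})"
  proof
    show "rho \<subseteq> tuples A n \<inter> \<Inter> (S ` {..<n})"
    proof
      fix xs assume xs: "xs \<in> rho"
      then have t: "xs \<in> tuples A n" using assms(2) by blast
      have "xs \<in> S i" if "i < n" for i
        using xs t tuples_nth[OF t that] list_update_id[of xs i] unfolding S_def by force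
      then show "xs \<in> tuples A n \<inter> \<Inter> (S ` {..<n})" using t by blast
    qed
    show "tuples A n \<inter> \<Inter> (S ` {..<n}) \<subseteq> rho"
      using no unfolding S_def by blast
  qed
  ultimately show False
    using assms(1) unfolding essential_def by (metis (no_types, lifting) imageE lessThan_iff)
qed

lemma pattern_less: "(i, j) \<in> pattern A n rho \<Longrightarrow> i < n \<and> j < n"
  by (simp add: pattern_def)

lemma pattern_refl: "i < n \<Longrightarrow> (i, i) \<in> pattern A n rho"
  by (simp add: pattern_def)

lemma pattern_sym:
  assumes "(i, j) \<in> pattern A n rho"
  shows "(j, i) \<in> pattern A n rho"
proof (cases "i = j")
  case False
  then have "a[j := bj, i := bi] = a[i := bi, j := bj]" for a :: "'a list" and bi bj
    by (rule list_update_swap[symmetric])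
  then show ?thesis using assms False unfolding pattern_def by auto
qed (use assms in simp)

section \<open>Sections at the key tuple\<close>

locale essential_key =
  fixes A :: "'a set" and n m :: nat and rho :: "'a list set" and f :: "'a list \<Rightarrow> 'a"
    and \<beta> :: "'a list"
  assumes wnu: "wnu A m f"
    and pres: "op_preserves m n f rho"
    and \<beta>: "\<beta> \<in> tuples A n" "\<beta> \<notin> rho"
    and key: "\<And>\<alpha>. \<alpha> \<in> tuples A n \<Longrightarrow> \<alpha> \<notin> rho \<Longrightarrow>
      \<exists>Psi. is_vf A n Psi \<and> vf_preserves Psi rho \<and> vf_apply Psi \<alpha> = \<beta>"
    and ess: "\<And>i. i < n \<Longrightarrow> \<exists>b\<in>A. \<beta>[i := b] \<in> rho"
begin

definition F :: "(nat \<Rightarrow> 'a) \<Rightarrow> 'a" where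
  "F x = f (map x [0..<m])"

lemma len: "length \<beta> = n"
  using \<beta> by (simp add: tuples_def)

lemma wnuD:
  shows "m \<ge> 2"
    and "xs \<in> tuples A m \<Longrightarrow> f xs \<in> A"
    and "x \<in> A \<Longrightarrow> f (replicate m x) = x"
    and "x \<in> A \<Longrightarrow> y \<in> A \<Longrightarrow> i < m \<Longrightarrow> j < m \<Longrightarrow>
      f ((replicate m x)[i := y]) = f ((replicate m x)[j := y])"
  using wnu unfolding wnu_def by blast+

sublocale wnu_family A m F
proof
  show "m \<ge> 2" by (rule wnuD)
  show "F x = F y" if "\<And>t. t < m \<Longrightarrow> x t = y t" for x y
  proof -
    have "map x [0..<m] = map y [0..<m]" using that by simp
    then show ?thesis unfolding F_def by (rule arg_cong)
  qed
  show "F x \<in> A" if "\<And>t. t < m \<Longrightarrow> x t \<in> A" for x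
  proof -
    have "map x [0..<m] \<in> tuples A m" using that by (auto simp: tuples_def)
    then show ?thesis unfolding F_def by (rule wnuD)
  qed
  show "F (\<lambda>_. x) = x" if "x \<in> A" for x
    using wnuD(3)[OF that] by (simp add: F_def map_replicate_const)
  show "F ((\<lambda>_. x)(i := y)) = F ((\<lambda>_. x)(j := y))"
    if "x \<in> A" "y \<in> A" "i < m" "j < m" for x y i j
  proof -
    have "map ((\<lambda>_. x)(r := y)) [0..<m] = (replicate m x)[r := y]" for r
      by (rule nth_equalityI) (auto simp: nth_update_lt)
    then show ?thesis using wnuD(4)[OF that] by (simp only: F_def)
  qed
qed

definition slice :: "nat \<Rightarrow> nat \<Rightarrow> nat \<Rightarrow> 'a \<Rightarrow> 'a \<Rightarrow> 'a \<Rightarrow> bool" where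
  "slice i j k x y z \<longleftrightarrow> x \<in> A \<and> y \<in> A \<and> z \<in> A \<and> \<beta>[i := x, j := y, k := z] \<in> rho"

definition pair :: "nat \<Rightarrow> nat \<Rightarrow> 'a \<Rightarrow> 'a \<Rightarrow> bool" where
  "pair i j x y \<longleftrightarrow> x \<in> A \<and> y \<in> A \<and> \<beta>[i := x, j := y] \<in> rho"

abbreviation vote :: "nat \<Rightarrow> nat \<Rightarrow> nat set \<Rightarrow> nat set \<Rightarrow> bool" where
  "vote i j \<equiv> vote_equiv F (pair i j) (\<beta> ! i) (\<beta> ! j)"

lemma slice_pres:
  assumes "\<And>t. t < m \<Longrightarrow> slice i j k (x t) (y t) (z t)"
  shows "slice i j k (F x) (F y) (F z)"
proof -
  let ?t = "\<lambda>t. \<beta>[i := x t, j := y t, k := z t]"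
  let ?ts = "map ?t [0..<m]"
  have "map (\<lambda>l. f (map (\<lambda>t. t ! l) ?ts)) [0..<n] \<in> rho"
  proof (rule pres[unfolded op_preserves_def, rule_format])
    show "length ?ts = m \<and> set ?ts \<subseteq> rho" using assms by (auto simp: slice_def)
  qed
  moreover have "map (\<lambda>l. f (map (\<lambda>t. t ! l) ?ts)) [0..<n] = \<beta>[i := F x, j := F y, k := F z]"
  proof (rule nth_equalityI)
    fix l assume l: "l < length (map (\<lambda>l. f (map (\<lambda>t. t ! l) ?ts)) [0..<n])"
    then have "map (\<lambda>l. f (map (\<lambda>t. t ! l) ?ts)) [0..<n] ! l = F (\<lambda>t. ?t t ! l)"
      by (simp add: F_def comp_def)
    \<comment> \<open>At frozen coordinates all arguments coincide, and idempotence returns the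
      entry of \<open>\<beta>\<close>.\<close>
    also have "\<dots> = \<beta>[i := F x, j := F y, k := F z] ! l"
      using l len F_idem[OF tuples_nth[OF \<beta>(1), of l]] by (auto simp: nth_update_lt)
    finally show "map (\<lambda>l. f (map (\<lambda>t. t ! l) ?ts)) [0..<n] ! l = \<beta>[i := F x, j := F y, k := F z] ! l" .
  qed (simp add: len)
  moreover have "F x \<in> A" "F y \<in> A" "F z \<in> A"
    using assms by (auto simp: slice_def intro!: F_closed)
  ultimately show ?thesis by (simp add: slice_def)
qed

lemma slice_tuples:
  assumes "x \<in> A" "y \<in> A" "z \<in> A"
  shows "\<beta>[i := x, j := y, k := z] \<in> tuples A n"
  using assms \<beta>(1) by (simp add: tuples_update)

lemma slice_key:
  assumes ijk: "i < n" "j < n" "k < n" "i \<noteq> j" "i \<noteq> k" "j \<noteq> k"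
    and xyz: "x \<in> A" "y \<in> A" "z \<in> A" "\<not> slice i j k x y z"
  shows "\<exists>p q r. p x = \<beta> ! i \<and> q y = \<beta> ! j \<and> r z = \<beta> ! k \<and>
    (\<forall>x y z. slice i j k x y z \<longrightarrow> slice i j k (p x) (q y) (r z))"
proof -
  let ?a = "\<beta>[i := x, j := y, k := z]"
  obtain Psi where Psi: "is_vf A n Psi" "vf_preserves Psi rho" "vf_apply Psi ?a = \<beta>"
    using key[OF slice_tuples] xyz unfolding slice_def by blast
  have nth: "Psi l (?a ! l) = \<beta> ! l" if "l < n" for l
    using nth_vf_apply[of l ?a Psi] Psi(3) that len by simp
  have "slice i j k (Psi i x') (Psi j y') (Psi k z')" if s: "slice i j k x' y' z'" for x' y' z'
  proof -
    have "vf_apply Psi (\<beta>[i := x', j := y', k := z']) = \<beta>[i := Psi i x', j := Psi j y', k := Psi k z']"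
    proof (rule nth_equalityI)
      fix l assume "l < length (vf_apply Psi (\<beta>[i := x', j := y', k := z']))"
      then have "l < n" by (simp add: length_vf_apply len)
      with nth[of l] show "vf_apply Psi (\<beta>[i := x', j := y', k := z']) ! l =
          \<beta>[i := Psi i x', j := Psi j y', k := Psi k z'] ! l"
        by (auto simp: nth_vf_apply len nth_update_lt split: if_splits)
    qed (simp add: length_vf_apply)
    then show ?thesis
      using s Psi(1,2) ijk unfolding slice_def is_vf_def vf_preserves_def by (metis image_subset_iff)
  qed
  moreover have "Psi i x = \<beta> ! i" "Psi j y = \<beta> ! j" "Psi k z = \<beta> ! k"
    using nth[of i] nth[of j] nth[of k] ijk len by (auto simp: nth_update_lt)
  ultimately show ?thesis by blast
qed

lemma slice_rectangular:
  assumes ij: "(i, j) \<in> pattern A n rho" and ijk: "i \<noteq> j" "i \<noteq> k" "j \<noteq> k"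
  shows "rectangular (\<lambda>x y. slice i j k x y z)"
  unfolding rectangular_def
proof (intro allI impI, elim conjE)
  fix x x' y y'
  assume R: "slice i j k x y z" "slice i j k x' y z" "slice i j k x' y' z"
  let ?a = "\<beta>[i := x, j := y', k := z]"
  have A: "x \<in> A" "x' \<in> A" "y \<in> A" "y' \<in> A" "z \<in> A" using R by (auto simp: slice_def)
  have upd: "?a[i := x'] = \<beta>[i := x', j := y', k := z]" "?a[j := y] = \<beta>[i := x, j := y, k := z]"
    "?a[i := x', j := y] = \<beta>[i := x', j := y, k := z]"
    using ijk by (simp_all add: list_eq_iff_nth_eq nth_update_lt)
  show "slice i j k x y' z"
  proof (rule ccontr)
    assume "\<not> slice i j k x y' z"
    then have "?a \<notin> rho" using A by (simp add: slice_def)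
    moreover have "?a[i := x'] \<in> rho" unfolding upd(1) using R by (simp add: slice_def)
    moreover have "?a[j := y] \<in> rho" unfolding upd(2) using R by (simp add: slice_def)
    moreover have "?a[i := x', j := y] \<in> rho" unfolding upd(3) using R by (simp add: slice_def)
    moreover have "?a \<in> tuples A n" using A by (simp add: slice_tuples)
    moreover have "t \<in> rho" if "t \<in> tuples A n" "t[i := x'] \<in> rho" "t[j := y] \<in> rho"
      "t[i := x', j := y] \<in> rho" for t
      using ij ijk(1) A that unfolding pattern_def by blast
    ultimately show False by blast
  qed
qed

lemma slice_base:
  assumes "k \<noteq> i" "k \<noteq> j" "k < n"
  shows "slice i j k x y (\<beta> ! k) \<longleftrightarrow> pair i j x y"
proof -
  have "\<beta>[i := x, j := y, k := \<beta> ! k] = \<beta>[i := x, j := y]"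
    by (rule nth_equalityI) (use assms in \<open>auto simp: nth_update_lt\<close>)
  then show ?thesis using tuples_nth[OF \<beta>(1)] assms by (simp add: slice_def pair_def)
qed

lemma pair_left: "i \<noteq> j \<Longrightarrow> j < n \<Longrightarrow> pair i j a (\<beta> ! j) \<longleftrightarrow> a \<in> A \<and> \<beta>[i := a] \<in> rho"
  using tuples_nth[OF \<beta>(1)] by (simp add: pair_def list_update_nth_other)

lemma pair_right: "i < n \<Longrightarrow> pair i j (\<beta> ! i) b \<longleftrightarrow> b \<in> A \<and> \<beta>[j := b] \<in> rho"
  using tuples_nth[OF \<beta>(1)] by (simp add: pair_def)

lemma ternary_key_slice:
  assumes ijk: "i < n" "j < n" "k < n" "i \<noteq> j" "i \<noteq> k" "j \<noteq> k"
    and ij: "(i, j) \<in> pattern A n rho"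
  shows "ternary_key A m F (slice i j k) (\<beta> ! i) (\<beta> ! j) (\<beta> ! k)"
proof
  show "\<exists>b. slice i j k (\<beta> ! i) b (\<beta> ! k)"
    using ess[of j] ijk by (auto simp: slice_base pair_right)
  show "\<not> slice i j k (\<beta> ! i) (\<beta> ! j) (\<beta> ! k)"
    using \<beta> ijk by (simp add: slice_base pair_right)
  show "slice i j k (F x) (F y) (F z)" if "\<And>t. t < m \<Longrightarrow> slice i j k (x t) (y t) (z t)" for x y z
    using that by (rule slice_pres)
  show "rectangular (\<lambda>x y. slice i j k x y z)" for z
    using slice_rectangular[OF ij] ijk by blast
  show "\<exists>p q r. p x = \<beta> ! i \<and> q y = \<beta> ! j \<and> r z = \<beta> ! k \<and>
      (\<forall>x y z. slice i j k x y z \<longrightarrow> slice i j k (p x) (q y) (r z))"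
    if "x \<in> A" "y \<in> A" "z \<in> A" "\<not> slice i j k x y z" for x y z
    using slice_key ijk that by blast
qed (use ijk tuples_nth[OF \<beta>(1)] in \<open>auto simp: slice_def\<close>)

text \<open>A vector-function sending the offending tuple to \<open>\<beta>\<close> carries its
  three neighbours in \<open>rho\<close> along.\<close>

lemma not_pattern_at_key_tuple:
  assumes "(i, k) \<notin> pattern A n rho" "i < n" "k < n"
  obtains a c where "i \<noteq> k" "a \<in> A" "c \<in> A" "\<beta>[i := a] \<in> rho" "\<beta>[k := c] \<in> rho"
    "\<beta>[i := a, k := c] \<in> rho"
proof -
  from assms obtain t a c where t: "i \<noteq> k" "t \<in> tuples A n" "a \<in> A" "c \<in> A" "t \<notin> rho"
    "t[i := a] \<in> rho" "t[k := c] \<in> rho" "t[i := a, k := c] \<in> rho"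
    unfolding pattern_def by blast
  from key[OF t(2,5)] obtain Psi where Psi: "is_vf A n Psi" "vf_preserves Psi rho" "vf_apply Psi t = \<beta>"
    by blast
  have "vf_apply Psi (t[i := a]) \<in> rho" "vf_apply Psi (t[k := c]) \<in> rho"
    "vf_apply Psi (t[i := a, k := c]) \<in> rho"
    using t Psi(2) by (auto simp: vf_preserves_def)
  moreover have "Psi i a \<in> A" "Psi k c \<in> A" using Psi(1) t assms by (auto simp: is_vf_def)
  ultimately show thesis using that t(1) Psi(3) by (simp add: vf_apply_update)
qed

section \<open>Transitivity and merging of classes\<close>

lemma slice_witness:
  assumes ijk: "i < n" "j < n" "k < n" "i \<noteq> j" "i \<noteq> k" "j \<noteq> k"
    and ik: "(i, k) \<notin> pattern A n rho"
  obtains a c where "slice i j k a (\<beta> ! j) (\<beta> ! k)" "slice i j k (\<beta> ! i) (\<beta> ! j) c"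
    "slice i j k a (\<beta> ! j) c"
proof -
  from not_pattern_at_key_tuple[OF ik ijk(1,3)] obtain a c where
    ac: "a \<in> A" "c \<in> A" "\<beta>[i := a] \<in> rho" "\<beta>[k := c] \<in> rho" "\<beta>[i := a, k := c] \<in> rho"
    by blast
  show thesis
    by (rule that[of a c])
      (use ac ijk tuples_nth[OF \<beta>(1)] in \<open>auto simp: slice_base pair_left slice_def[of i j k _ _ c]
        list_update_nth_other\<close>)
qed

text \<open>The face of the box with first entry \<open>\<beta> ! i\<close> is a failure of the
  pattern at \<open>(j, k)\<close>.\<close>

lemma not_pattern_trans:
  assumes ijk: "i < n" "j < n" "k < n" "i \<noteq> j" "i \<noteq> k" "j \<noteq> k"
    and ij: "(i, j) \<in> pattern A n rho" and ik: "(i, k) \<notin> pattern A n rho"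
  shows "(j, k) \<notin> pattern A n rho"
proof
  assume jk: "(j, k) \<in> pattern A n rho"
  interpret ternary_key A m F "slice i j k" "\<beta> ! i" "\<beta> ! j" "\<beta> ! k"
    by (rule ternary_key_slice[OF ijk ij])
  from slice_witness[OF ijk ik] box_exists obtain a b c where "box a b c" by metis
  then have bc: "slice i j k (\<beta> ! i) b (\<beta> ! k)" "slice i j k (\<beta> ! i) (\<beta> ! j) c"
    "slice i j k (\<beta> ! i) b c"
    unfolding box_def by auto
  then have "\<beta>[j := b] \<in> rho" "\<beta>[k := c] \<in> rho" "\<beta>[j := b, k := c] \<in> rho" "b \<in> A" "c \<in> A"
    using ijk by (auto simp: slice_base pair_right) (auto simp: slice_def)
  then show False using jk \<beta> ijk unfolding pattern_def by blast
qed

lemma voting_vote: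
  assumes ijk: "i < n" "j < n" "k < n" "i \<noteq> j" "i \<noteq> k" "j \<noteq> k"
    and ij: "(i, j) \<in> pattern A n rho" and ik: "(i, k) \<notin> pattern A n rho"
  shows "voting m (vote i j)"
    and "\<exists>c\<in>A. \<beta>[k := c] \<in> rho \<and>
      (\<forall>S. \<not> determined_by (vote i j) S \<longrightarrow> \<beta>[k := F (mix S (\<beta> ! k) c)] \<in> rho)"
proof -
  interpret ternary_key A m F "slice i j k" "\<beta> ! i" "\<beta> ! j" "\<beta> ! k"
    by (rule ternary_key_slice[OF ijk ij])
  obtain a c where ac: "slice i j k a (\<beta> ! j) (\<beta> ! k)" "slice i j k (\<beta> ! i) (\<beta> ! j) c"
    "slice i j k a (\<beta> ! j) c"
    using slice_witness[OF ijk ik] by metis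
  have eq: "(\<lambda>x y. slice i j k x y (\<beta> ! k)) = pair i j"
    using ijk by (auto simp: slice_base fun_eq_iff)
  show "voting m (vote i j)" using voting_vote_equiv[OF ac(1)] unfolding eq .
  show "\<exists>c\<in>A. \<beta>[k := c] \<in> rho \<and>
      (\<forall>S. \<not> determined_by (vote i j) S \<longrightarrow> \<beta>[k := F (mix S (\<beta> ! k) c)] \<in> rho)"
    using determined_by_or_outvoted[OF ac] unfolding eq by (auto simp: slice_def)
qed

lemma vote_left:
  assumes "i < n" "j < n" "i \<noteq> j" "a \<in> A" "\<beta>[i := a] \<in> rho"
    and F: "\<beta>[i := F (mix S (\<beta> ! i) a)] \<in> rho"
  shows "vote i j S {}"
proof -
  obtain b where "b \<in> A" "\<beta>[j := b] \<in> rho" using ess assms by blast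
  moreover have "F (mix S (\<beta> ! i) a) \<in> A"
    by (rule F_closed) (use assms tuples_nth[OF \<beta>(1)] in \<open>auto simp: mix_apply\<close>)
  ultimately show ?thesis
    unfolding vote_equiv_def using assms tuples_nth[OF \<beta>(1)]
    by (intro exI[of _ a] exI[of _ b]) (simp add: pair_left pair_right F_mix_empty)
qed

text \<open>On the right it is \<open>b\<close> that represents the class of
  \<open>\<beta> ! i\<close>, whence the complement of \<open>S\<close>.\<close>

lemma vote_right:
  assumes "i < n" "j < n" "i \<noteq> j" "b \<in> A" "\<beta>[j := b] \<in> rho"
    and F: "\<beta>[j := F (mix S (\<beta> ! j) b)] \<in> rho"
  shows "vote i j UNIV (- S)"
proof -
  obtain a where "a \<in> A" "\<beta>[i := a] \<in> rho" using ess assms by blast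
  moreover have "F (mix S (\<beta> ! j) b) \<in> A"
    by (rule F_closed) (use assms tuples_nth[OF \<beta>(1)] in \<open>auto simp: mix_apply\<close>)
  moreover have "mix (- S) b (\<beta> ! j) = mix S (\<beta> ! j) b" by (auto simp: mix_def)
  ultimately show ?thesis
    unfolding vote_equiv_def using assms tuples_nth[OF \<beta>(1)]
    by (intro exI[of _ a] exI[of _ b]) (simp add: pair_left pair_right F_mix_full)
qed

text \<open>If the classes differed, sets not determining one vote would lose at the coordinates of
  the other pair, in both directions, against \<open>no_two_votings\<close>.\<close>

lemma pattern_merge:
  assumes n: "i < n" "j < n" "k < n" "l < n"
    and ne: "i \<noteq> j" "i \<noteq> k" "i \<noteq> l" "j \<noteq> k" "j \<noteq> l" "k \<noteq> l"
    and ij: "(i, j) \<in> pattern A n rho" and kl: "(k, l) \<in> pattern A n rho"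
  shows "(i, k) \<in> pattern A n rho"
proof (rule ccontr)
  assume ik: "(i, k) \<notin> pattern A n rho"
  then have ki: "(k, i) \<notin> pattern A n rho" using pattern_sym by blast
  have "(j, k) \<notin> pattern A n rho" by (rule not_pattern_trans[OF _ _ _ _ _ _ ij ik]) (use n ne in auto)
  then have kj: "(k, j) \<notin> pattern A n rho" using pattern_sym by blast
  obtain c where c: "c \<in> A" "\<beta>[k := c] \<in> rho"
    "\<And>S. \<not> determined_by (vote i j) S \<Longrightarrow> \<beta>[k := F (mix S (\<beta> ! k) c)] \<in> rho"
    using voting_vote(2)[OF _ _ _ _ _ _ ij ik] n ne by blast
  obtain a where a: "a \<in> A" "\<beta>[i := a] \<in> rho"
    "\<And>S. \<not> determined_by (vote k l) S \<Longrightarrow> \<beta>[i := F (mix S (\<beta> ! i) a)] \<in> rho"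
    using voting_vote(2)[OF _ _ _ _ _ _ kl ki] n ne by metis
  obtain b where b: "b \<in> A" "\<beta>[j := b] \<in> rho"
    "\<And>S. \<not> determined_by (vote k l) S \<Longrightarrow> \<beta>[j := F (mix S (\<beta> ! j) b)] \<in> rho"
    using voting_vote(2)[OF _ _ _ _ _ _ kl kj] n ne by metis
  show False
  proof (rule no_two_votings)
    show "voting m (vote i j)" by (rule voting_vote(1)[OF _ _ _ _ _ _ ij ik]) (use n ne in auto)
    show "voting m (vote k l)" by (rule voting_vote(1)[OF _ _ _ _ _ _ kl ki]) (use n ne in auto)
    show "vote k l S {}" if "\<not> determined_by (vote i j) S" for S
      by (rule vote_left[OF n(3,4) ne(6) c(1,2) c(3)[OF that]])
    show "vote i j S {}" if "\<not> determined_by (vote k l) S" for S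
      by (rule vote_left[OF n(1,2) ne(1) a(1,2) a(3)[OF that]])
    show "vote i j UNIV (- S)" if "\<not> determined_by (vote k l) S" for S
      by (rule vote_right[OF n(1,2) ne(1) b(1,2) b(3)[OF that]])
  qed
qed

lemma trans_pattern: "trans (pattern A n rho)"
proof (rule transI, rule ccontr)
  fix i j k
  assume ij: "(i, j) \<in> pattern A n rho" and jk: "(j, k) \<in> pattern A n rho"
    and ik: "(i, k) \<notin> pattern A n rho"
  have "i < n" "j < n" "k < n" using pattern_less[OF ij] pattern_less[OF jk] by simp_all
  moreover from this have "i \<noteq> j" "i \<noteq> k" "j \<noteq> k" using ij jk ik pattern_refl by metis+
  ultimately show False using not_pattern_trans[OF _ _ _ _ _ _ ij ik] jk by simp
qed

lemma equiv_pattern: "equiv {0..<n} (pattern A n rho)"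
proof (rule equivI)
  show "pattern A n rho \<subseteq> {0..<n} \<times> {0..<n}" using pattern_less by fastforce
  show "refl_on {0..<n} (pattern A n rho)" by (simp add: refl_on_def pattern_refl)
  show "sym (pattern A n rho)" using pattern_sym by (rule symI)
qed (rule trans_pattern)

end

theorem mainTheorem3:
  fixes A :: "'a set" and n m :: nat and rho :: "'a list set" and f :: "'a list \<Rightarrow> 'a"
  assumes "finite A"
    and "n \<ge> 3"
    and "rho \<subseteq> tuples A n"
    and "essential A n rho"
    and "key_relation A n rho"
    and "wnu A m f"
    and "op_preserves m n f rho"
  shows "equiv {0..<n} (pattern A n rho) \<and>
         (\<forall>C \<in> {0..<n} // pattern A n rho. \<forall>D \<in> {0..<n} // pattern A n rho.
            card C > 1 \<and> card D > 1 \<longrightarrow> C = D)"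
proof -
  from assms(5) have "\<exists>\<beta>\<in>tuples A n - rho. \<forall>\<alpha>\<in>tuples A n - rho.
      \<exists>Psi. is_vf A n Psi \<and> vf_preserves Psi rho \<and> vf_apply Psi \<alpha> = \<beta>"
    unfolding key_relation_def by (rule conjunct2)
  then obtain \<beta> where \<beta>: "\<beta> \<in> tuples A n" "\<beta> \<notin> rho" and
    key: "\<And>\<alpha>. \<alpha> \<in> tuples A n \<Longrightarrow> \<alpha> \<notin> rho \<Longrightarrow>
      \<exists>Psi. is_vf A n Psi \<and> vf_preserves Psi rho \<and> vf_apply Psi \<alpha> = \<beta>"
    by (elim bexE DiffE) simp
  obtain \<alpha> where \<alpha>: "\<alpha> \<in> tuples A n" "\<alpha> \<notin> rho" "\<And>i. i < n \<Longrightarrow> \<exists>b\<in>A. \<alpha>[i := b] \<in> rho"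
    using essential_tuple[OF assms(4,3)] by (elim bexE DiffE) simp
  from key[OF \<alpha>(1,2)] obtain Psi where
    Psi: "is_vf A n Psi" "vf_preserves Psi rho" "vf_apply Psi \<alpha> = \<beta>" by blast
  \<comment> \<open>The map from \<open>\<alpha>\<close> to \<open>\<beta>\<close> transports the
    witness of essentiality.\<close>
  have "\<exists>b\<in>A. \<beta>[i := b] \<in> rho" if i: "i < n" for i
  proof -
    obtain b where "b \<in> A" "\<alpha>[i := b] \<in> rho" using \<alpha>(3)[OF i] by blast
    then have "Psi i b \<in> A" "\<beta>[i := Psi i b] \<in> rho"
      using Psi i vf_apply_update[of Psi \<alpha> i b] by (auto simp: is_vf_def vf_preserves_def)
    then show ?thesis by blast
  qed
  with assms(6,7) \<beta> key interpret essential_key A n m rho f \<beta>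
    by (rule essential_key.intro)
  have "C = D" if C: "C \<in> {0..<n} // pattern A n rho" "card C > 1"
    and D: "D \<in> {0..<n} // pattern A n rho" "card D > 1" for C D
  proof (rule ccontr)
    assume "C \<noteq> D"
    then have disj: "C \<inter> D = {}" using quotient_disj[OF equiv_pattern C(1) D(1)] by blast
    have two: "\<exists>i j. i \<in> C \<and> j \<in> C \<and> i \<noteq> j" if "card C > 1" for C :: "nat set"
      using that card_le_Suc0_iff_eq[of C] card_ge_0_finite[of C] by fastforce
    obtain i j k l where e: "i \<in> C" "j \<in> C" "i \<noteq> j" "k \<in> D" "l \<in> D" "k \<noteq> l"
      using two C(2) D(2) by meson
    have ij: "(i, j) \<in> pattern A n rho" "(k, l) \<in> pattern A n rho"
      using e quotient_eq_iff[OF equiv_pattern C(1) C(1)] quotient_eq_iff[OF equiv_pattern D(1) D(1)]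
      by simp_all
    have "(i, k) \<in> pattern A n rho"
      by (rule pattern_merge[OF _ _ _ _ _ _ _ _ _ _ ij])
        (use e disj pattern_less[OF ij(1)] pattern_less[OF ij(2)] in auto)
    then show False using quotient_eq_iff[OF equiv_pattern C(1) D(1) e(1,4)] \<open>C \<noteq> D\<close> by blast
  qed
  then show ?thesis using equiv_pattern by blast
qed

end
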